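(* Let $\|\cdot\|$ be a phs-functional on $\mathbb R^2$, let $p,q\in\mathbb R$ with $q\neq 0$, and assume that $Q(z)\ge\frac{p^2}{4q}$ for all $z\in\mathbb R^2\setminus\{\mathfrak o\}$. Consider the vector equation $$z\circ z+p\,z+q\,\mathbf 1=\mathfrak o,\qquad z=(x,y)^T\in\mathbb R^2 .$$ (a) Suppose $p\neq 0$. Every solution $z=(x,y)^T$ of this equation with $y\neq0$ belongs to the circle $$\Big\{(x,y)^T\in\mathbb R^2:\Big(x+\frac qp\Big)^2+y^2=\Big(\frac qp\Big)^2\Big\}$$ and satisfies the equations $$x=-\frac{p}{2Q(z)}\quad\text{and}\quad y^2=\frac{q}{Q(z)}-\Big(\frac{p}{2Q(z)}\Big)^2 .$$ (b) If $\frac{p^2}{4}-q\ge0$, then every solution of this equation with $y=0$ can be represented as $z=(x,0)^T$, where $x$ solves $x^2+px+q=0$, i.e. $x\in\Big\{-\frac p2+\sqrt{\frac{p^2}{4}-q},\,-\frac p2-\sqrt{\frac{p^2}{4}-q}\Big\}$.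
   Context: Vectors in $\mathbb R^2$ are columns; addition and multiplication by real scalars are the usual componentwise operations. Notation: $\mathbf 1=(1,0)^T$, $\mathfrak o=(0,0)^T$. A phs-functional is a positively homogeneous functional $\|\cdot\|:\mathbb R^2\to[0,\infty)$ (i.e. $\|\lambda z\|=\lambda\|z\|$ for $\lambda\ge 0$) such that $B=\{z\in\mathbb R^2:\|z\|\le1\}$ is star-shaped with respect to the interior point $\mathfrak o$; moreover $\|z\|>0$ for $z\neq\mathfrak o$. The circular product on $\mathbb R^2$ is $(x_1,y_1)^T\circledast(x_2,y_2)^T=(x_1x_2-y_1y_2,\;x_1y_2+x_2y_1)^T$. The vector-valued product with respect to $\|\cdot\|$ is $$z_1\circ z_2=\frac{\|z_1\|\,\|z_2\|}{\|z_1\circledast z_2\|}\,(z_1\circledast z_2),$$ with $z_1\circ z_2=\mathfrak o$ if $z_1=\mathfrak o$ or $z_2=\mathfrak o$. For $z\ne\mathfrak o$ put $Q(z)=\dfrac{\|z\|^2}{\|z\circledast z\|}$, so that $z\circ z=Q(z)\,(z\circledast z)$.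
   Formalization: Part (b) is proved under the added assumption ‖(1,0)‖ = ‖(−1,0)‖ = 1 (so Q = 1 on the first axis); without it (b) fails, e.g. for ‖z‖ = 2|z| (Euclidean), p = 1, q = −1, z = (1/2, 0). *)

theory Defs
  imports "HOL-Analysis.Analysis"
begin

definition phs_functional :: "(real^2 \<Rightarrow> real) \<Rightarrow> bool" where
  "phs_functional N \<longleftrightarrow>
     (\<forall>z. 0 \<le> N z) \<and>
     (\<forall>z. z \<noteq> 0 \<longrightarrow> 0 < N z) \<and>
     (\<forall>c z. 0 \<le> c \<longrightarrow> N (c *\<^sub>R z) = c * N z) \<and>
     0 \<in> interior {z. N z \<le> 1} \<and>
     (\<forall>z \<in> {z. N z \<le> 1}. closed_segment 0 z \<subseteq> {z. N z \<le> 1})"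

definition one_vec :: "real^2" where
  "one_vec = vector [1, 0]"

definition circ_prod :: "real^2 \<Rightarrow> real^2 \<Rightarrow> real^2"  (infixl "\<circledast>" 70) where
  "z \<circledast> w = vector [z$1 * w$1 - z$2 * w$2, z$1 * w$2 + w$1 * z$2]"

definition vprod :: "(real^2 \<Rightarrow> real) \<Rightarrow> real^2 \<Rightarrow> real^2 \<Rightarrow> real^2" where
  "vprod N z w =
     (if z = 0 \<or> w = 0 then 0 else (N z * N w / N (z \<circledast> w)) *\<^sub>R (z \<circledast> w))"

(* Only meaningful for z \<noteq> 0. A phs-functional need be neither normalised nor symmetric:
   at (x,0), Q is N (1,0) for x > 0 and N (-1,0)^2 / N (1,0) for x < 0. Hence z \<circ> z = z \<circledast> z
   on the first axis, so that the vector equation restricts there to x^2 + p x + q = 0, exactly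
   when N (1,0) = N (-1,0) = 1. *)
definition Q :: "(real^2 \<Rightarrow> real) \<Rightarrow> real^2 \<Rightarrow> real" where
  "Q N z = (N z)\<^sup>2 / N (z \<circledast> z)"

end

theory Submission
  imports Defs
begin

text \<open>The product \<circledast> is complex multiplication, so \<open>vprod N z z\<close> is
  the complex square of \<open>z\<close> scaled by \<open>Q N z\<close>. Writing k for
  \<open>Q N z\<close>, the equation splits into k(x^2 - y^2) + px + q = 0 and y(2kx + p) = 0
  (\<open>vector_equation_iff\<close>). Off the first axis the second equation forces x = -p/(2k),
  where k > 0 by \<open>Q_pos\<close>; the first then gives y^2, and eliminating k leaves the
  circle. On the axis, the normalisation of \<open>N\<close> at \<open>one_vec\<close> and
  \<open>- one_vec\<close> makes k = 1 (\<open>Q_first_axis\<close>), and the ordinary real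
  quadratic remains.\<close>

lemma circ_prod_self_eq_0_iff: "z \<circledast> z = 0 \<longleftrightarrow> z = 0"
proof
  assume "z \<circledast> z = 0"
  then have "(z$1)\<^sup>2 = (z$2)\<^sup>2" "z$1 * z$2 = 0"
    by (auto simp: circ_prod_def vec_eq_iff forall_2 power2_eq_square)
  then show "z = 0"
    by (auto simp: vec_eq_iff forall_2)
qed (simp add: circ_prod_def vec_eq_iff forall_2)

lemma Q_pos:
  assumes "phs_functional N" and "z \<noteq> 0"
  shows "0 < Q N z"
proof -
  have "0 < N z" and "0 < N (z \<circledast> z)"
    using assms circ_prod_self_eq_0_iff[of z] by (auto simp: phs_functional_def)
  then show ?thesis
    by (simp add: Q_def)
qed

text \<open>At \<open>z = 0\<close> both sides vanish because \<open>z \<circledast> z\<close> does,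
  so the equation can be rewritten before \<open>z\<close> is known to be nonzero.\<close>

lemma vprod_self: "vprod N z z = Q N z *\<^sub>R (z \<circledast> z)"
  by (auto simp: vprod_def Q_def power2_eq_square circ_prod_self_eq_0_iff)

lemma vector_equation_iff:
  "vprod N z z + p *\<^sub>R z + q *\<^sub>R one_vec = 0 \<longleftrightarrow>
     Q N z * ((z$1)\<^sup>2 - (z$2)\<^sup>2) + p * z$1 + q = 0 \<and>
     z$2 * (2 * Q N z * z$1 + p) = 0"
  by (simp add: vprod_self circ_prod_def one_vec_def vec_eq_iff forall_2 power2_eq_square
      algebra_simps)

text \<open>Squaring sends both half-axes to the positive one, so the denominator of
  \<open>Q\<close> only sees \<open>one_vec\<close>, while the numerator sees the half-axis of
  \<open>z\<close> itself.\<close>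

lemma Q_first_axis:
  assumes phs: "phs_functional N" and N1: "N one_vec = 1" "N (- one_vec) = 1"
    and z: "z$2 = 0" "z \<noteq> 0"
  shows "Q N z = 1"
proof -
  have hom: "N (c *\<^sub>R v) = c * N v" if "0 \<le> c" for c v
    using phs that by (simp add: phs_functional_def)
  have x: "z$1 \<noteq> 0" and zx: "z = z$1 *\<^sub>R one_vec"
    using z by (auto simp: one_vec_def vec_eq_iff forall_2)
  have "z \<circledast> z = (z$1)\<^sup>2 *\<^sub>R one_vec"
    using z by (simp add: circ_prod_def one_vec_def vec_eq_iff forall_2 power2_eq_square)
  then have sq: "N (z \<circledast> z) = (z$1)\<^sup>2"
    using N1 by (simp add: hom)
  \<comment> \<open>Homogeneity covers nonnegative factors only, so a negative coordinate is handled
    as a positive multiple of \<open>- one_vec\<close>.\<close>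
  have "N z = \<bar>z$1\<bar>"
  proof (cases "0 \<le> z$1")
    case True
    then show ?thesis
      using hom[of "z$1" one_vec] N1 zx by simp
  next
    case False
    then show ?thesis
      using hom[of "- z$1" "- one_vec"] N1 zx by simp
  qed
  with sq x show ?thesis
    by (simp add: Q_def)
qed

text \<open>Completing the square turns the discriminant term into (x + p/2)^2; the sign of x + p/2
  selects the root.\<close>

lemma quadratic_root_cases:
  fixes x p q :: real
  assumes "x\<^sup>2 + p * x + q = 0"
  shows "x \<in> {- p / 2 + sqrt (p\<^sup>2 / 4 - q), - p / 2 - sqrt (p\<^sup>2 / 4 - q)}"
proof -
  have "p\<^sup>2 / 4 - q = (x + p / 2)\<^sup>2"
    using assms by (simp add: power2_eq_square field_simps)
  then have "sqrt (p\<^sup>2 / 4 - q) = \<bar>x + p / 2\<bar>"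
    by simp
  then show ?thesis
    by (auto simp: abs_if)
qed

theorem theorem4p1:
  fixes N :: "real^2 \<Rightarrow> real" and p q :: real
  assumes "phs_functional N"
    and "q \<noteq> 0"
    and "\<And>z. z \<noteq> 0 \<Longrightarrow> Q N z \<ge> p\<^sup>2 / (4 * q)"
  shows "(p \<noteq> 0 \<longrightarrow>
            (\<forall>z :: real^2. vprod N z z + p *\<^sub>R z + q *\<^sub>R one_vec = 0 \<and> z$2 \<noteq> 0 \<longrightarrow>
               z \<in> {w. (w$1 + q / p)\<^sup>2 + (w$2)\<^sup>2 = (q / p)\<^sup>2} \<and>
               z$1 = - p / (2 * Q N z) \<and>
               (z$2)\<^sup>2 = q / Q N z - (p / (2 * Q N z))\<^sup>2)) \<and>
         (p\<^sup>2 / 4 - q \<ge> 0 \<and> N one_vec = 1 \<and> N (- one_vec) = 1 \<longrightarrow>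
            (\<forall>z :: real^2. vprod N z z + p *\<^sub>R z + q *\<^sub>R one_vec = 0 \<and> z$2 = 0 \<longrightarrow>
               (\<exists>x :: real. z = vector [x, 0] \<and> x\<^sup>2 + p * x + q = 0 \<and>
                  x \<in> {- p / 2 + sqrt (p\<^sup>2 / 4 - q), - p / 2 - sqrt (p\<^sup>2 / 4 - q)})))"
proof (intro conjI impI allI; elim conjE)
  fix z :: "real^2"
  assume p: "p \<noteq> 0" and eq: "vprod N z z + p *\<^sub>R z + q *\<^sub>R one_vec = 0" and y: "z$2 \<noteq> 0"
  define k where "k = Q N z"
  have "z \<noteq> 0"
    using y by auto
  then have k: "0 < k"
    unfolding k_def by (rule Q_pos[OF assms(1)])
  have first: "k * ((z$1)\<^sup>2 - (z$2)\<^sup>2) + p * z$1 + q = 0" and "2 * k * z$1 + p = 0"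
    using eq y by (auto simp: vector_equation_iff k_def)
  then have x: "z$1 = - p / (2 * k)"
    using k by (simp add: field_simps)
  have "(z$2)\<^sup>2 = (z$1)\<^sup>2 + (p * z$1 + q) / k"
    using first k by (simp add: field_simps)
  then have y2: "(z$2)\<^sup>2 = q / k - (p / (2 * k))\<^sup>2"
    using k by (simp add: x power2_eq_square field_simps)
  \<comment> \<open>The x^2 term cancels (p/(2k))^2, and the cross term 2xq/p = -q/k cancels
    q/k.\<close>
  have "(z$1 + q / p)\<^sup>2 + (z$2)\<^sup>2 = (q / p)\<^sup>2"
    unfolding y2 x using k p by (simp add: power2_eq_square field_simps)
  with x y2 show "z \<in> {w. (w$1 + q / p)\<^sup>2 + (w$2)\<^sup>2 = (q / p)\<^sup>2}"
    and "z$1 = - p / (2 * Q N z)"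
    and "(z$2)\<^sup>2 = q / Q N z - (p / (2 * Q N z))\<^sup>2"
    by (simp_all add: k_def)
next
  fix z :: "real^2"
  assume N1: "N one_vec = 1" "N (- one_vec) = 1"
    and eq: "vprod N z z + p *\<^sub>R z + q *\<^sub>R one_vec = 0" and y: "z$2 = 0"
  \<comment> \<open>At the origin the first component of the equation would read q = 0.\<close>
  have "z \<noteq> 0"
    using eq assms(2) by (auto simp: vector_equation_iff)
  then have "Q N z = 1"
    using Q_first_axis[OF assms(1) N1 y] by simp
  then have root: "(z$1)\<^sup>2 + p * z$1 + q = 0"
    using eq y by (simp add: vector_equation_iff)
  moreover have "z = vector [z$1, 0]"
    using y by (simp add: vec_eq_iff forall_2)
  ultimately show "\<exists>x :: real. z = vector [x, 0] \<and> x\<^sup>2 + p * x + q = 0 \<and>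
      x \<in> {- p / 2 + sqrt (p\<^sup>2 / 4 - q), - p / 2 - sqrt (p\<^sup>2 / 4 - q)}"
    using quadratic_root_cases by blast
qed

end
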